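(* Let $X$ be a real Banach space and let $T$ be a countably compact (Hausdorff) topological space with a distinguished point $\infty\in T$. Suppose there is a function $f:T\to X$ such that: (i) $f(\infty)=0$; (ii) the set $Y:=\{x^*\in X^*: x^*\circ f \text{ is continuous}\}$ is a norming and norm-closed subspace of $X^*$; (iii) there exist $\varepsilon>0$ and $x^*_\infty\in X^*$ such that the set $D:=\{t\in T: x^*_\infty(f(t))>\varepsilon\}$ intersects every $G_\delta$-subset of $T$ containing $\infty$. Then $X$ is not fully Mackey complete.
   Context: A topological space is countably compact if every sequence in it has a cluster point. A linear subspace $Y\subset X^*$ is norming if $|||x|||=\sup\{x^*(x): x^*\in Y,\ \|x^*\|\le 1\}$ defines an equivalent norm on $X$. $X$ is fully Mackey complete if $(X,\mu(X,Y))$ is complete for every norming and norm-closed subspace $Y\subset X^*$, where $\mu(X,Y)$ is the locally convex topology on $X$ of uniform convergence on absolutely convex $w^*$-compact subsets of $Y$. *)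

theory Defs
  imports "HOL-Analysis.Analysis"
begin

definition countably_compact_space :: "'t topology \<Rightarrow> bool" where
  "countably_compact_space T \<longleftrightarrow>
     (\<forall>\<sigma>::nat \<Rightarrow> 't. range \<sigma> \<subseteq> topspace T \<longrightarrow>
        (\<exists>t\<in>topspace T. \<forall>U. openin T U \<and> t \<in> U \<longrightarrow> infinite {n. \<sigma> n \<in> U}))"

definition weak_star_topology :: "('a::real_normed_vector \<Rightarrow>\<^sub>L real) topology" where
  "weak_star_topology =
     topology_generated_by {{\<phi>. blinfun_apply \<phi> x \<in> U} | x U. open U}"

definition absolutely_convex :: "'b::real_vector set \<Rightarrow> bool" where
  "absolutely_convex K \<longleftrightarrow> convex K \<and> (\<forall>\<phi>\<in>K. \<forall>c::real. \<bar>c\<bar> \<le> 1 \<longrightarrow> c *\<^sub>R \<phi> \<in> K)"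

definition norming :: "('a::real_normed_vector \<Rightarrow>\<^sub>L real) set \<Rightarrow> bool" where
  "norming Y \<longleftrightarrow> subspace Y \<and>
     (\<exists>c>0. \<exists>C. \<forall>x::'a.
        c * norm x \<le> (SUP \<phi>\<in>{\<phi>\<in>Y. norm \<phi> \<le> 1}. blinfun_apply \<phi> x) \<and>
        (SUP \<phi>\<in>{\<phi>\<in>Y. norm \<phi> \<le> 1}. blinfun_apply \<phi> x) \<le> C * norm x)"

definition mackey_set :: "('a::real_normed_vector \<Rightarrow>\<^sub>L real) set \<Rightarrow> ('a \<Rightarrow>\<^sub>L real) set \<Rightarrow> bool" where
  "mackey_set Y K \<longleftrightarrow> K \<subseteq> Y \<and> absolutely_convex K \<and> compactin weak_star_topology K"

text \<open>(X, mu(X,Y)) is complete: every proper Cauchy filter (for the uniformity of uniform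
  convergence on the Mackey sets) converges.\<close>
definition mackey_complete :: "('a::real_normed_vector \<Rightarrow>\<^sub>L real) set \<Rightarrow> bool" where
  "mackey_complete Y \<longleftrightarrow>
     (\<forall>F::'a filter. F \<noteq> bot \<and>
        (\<forall>K. mackey_set Y K \<longrightarrow> (\<forall>e>0.
            eventually (\<lambda>(x, y). \<forall>\<phi>\<in>K. \<bar>blinfun_apply \<phi> x - blinfun_apply \<phi> y\<bar> \<le> e) (F \<times>\<^sub>F F)))
      \<longrightarrow> (\<exists>x0. \<forall>K. mackey_set Y K \<longrightarrow> (\<forall>e>0.
            eventually (\<lambda>y. \<forall>\<phi>\<in>K. \<bar>blinfun_apply \<phi> y - blinfun_apply \<phi> x0\<bar> \<le> e) F)))"

definition fully_mackey_complete :: "'a::real_normed_vector itself \<Rightarrow> bool" where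
  "fully_mackey_complete _ \<longleftrightarrow>
     (\<forall>Y::('a \<Rightarrow>\<^sub>L real) set. norming Y \<and> closed Y \<longrightarrow> mackey_complete Y)"

end

theory Submission
  imports Defs
begin

text \<open>Let \<open>\<phi>\<close> be the functional of hypothesis (iii) and \<open>Z = Y \<oplus> \<real> \<phi>\<close>, which is norming and closed.
  The linear functional \<open>y + c \<phi> \<mapsto> c\<close> on \<open>Z\<close> is not an evaluation at a point of \<open>X\<close>, since its kernel
  \<open>Y\<close> is norming. If \<open>K \<inter> Y\<close> is weak-star compact for every Mackey set \<open>K\<close> of \<open>Z\<close>, separating
  multiples of \<open>\<phi>\<close> from such sets shows that this functional is, uniformly on each Mackey set,
  approximated by points of \<open>X\<close>; these approximations form a Cauchy filter without a limit.
  The compactness of \<open>K \<inter> Y\<close> is a double limit argument: countably many members of \<open>Y\<close> have common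
  zeros \<open>f t\<close> with \<open>\<phi> (f t) > \<epsilon>\<close>, and both \<open>K\<close> and \<open>T\<close> provide cluster points of sequences.\<close>

section \<open>Weak-star topology: evaluations, compactness and separation\<close>

lemma topspace_weak_star [simp]: "topspace weak_star_topology = UNIV"
  unfolding weak_star_topology_def topology_generated_by_topspace
  by (auto intro!: exI[of _ "UNIV::real set"])

lemma continuous_map_weak_star_iff:
  fixes g :: "'b \<Rightarrow> 'a::real_normed_vector \<Rightarrow>\<^sub>L real"
  shows "continuous_map X weak_star_topology g \<longleftrightarrow>
     (\<forall>x. continuous_map X euclideanreal (\<lambda>p. blinfun_apply (g p) x))"
  (is "?L \<longleftrightarrow> ?R")
proof -
  have UNIV: "\<Union>{{\<phi> :: 'a \<Rightarrow>\<^sub>L real. blinfun_apply \<phi> x \<in> U} | x U. open U} = UNIV"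
    using topspace_weak_star unfolding weak_star_topology_def topology_generated_by_topspace .
  have "?L \<longleftrightarrow> (\<forall>x U. open U \<longrightarrow> openin X (g -` {\<phi>. blinfun_apply \<phi> x \<in> U} \<inter> topspace X))"
    unfolding weak_star_topology_def continuous_on_generated_topo_iff UNIV by blast
  also have "\<dots> \<longleftrightarrow> ?R"
    unfolding continuous_map_alt by (auto simp: vimage_def)
  finally show ?thesis .
qed

lemma continuous_map_weak_star_apply [continuous_intros]:
  "continuous_map weak_star_topology euclideanreal (\<lambda>\<phi>. blinfun_apply \<phi> x)"
  by (rule continuous_map_weak_star_iff[THEN iffD1, rule_format])
     (simp add: continuous_map_id[unfolded id_def])

lemma openin_weak_star_preimage:
  "open U \<Longrightarrow> openin weak_star_topology {\<phi>. blinfun_apply \<phi> x \<in> U}"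
  unfolding weak_star_topology_def by (rule topology_generated_by_Basis) auto

lemma compactin_weak_star_bounded:
  assumes "compactin weak_star_topology K"
  shows "\<exists>B. \<forall>\<psi>\<in>K. \<bar>blinfun_apply \<psi> x\<bar> \<le> B"
proof -
  have "compactin euclideanreal ((\<lambda>\<phi>. blinfun_apply \<phi> x) ` K)"
    using assms continuous_map_weak_star_apply by (rule image_compactin)
  then have "bounded ((\<lambda>\<phi>. blinfun_apply \<phi> x) ` K)"
    by (simp add: compact_imp_bounded)
  then show ?thesis
    by (auto simp: bounded_iff)
qed

text \<open>Otherwise \<open>K\<close> is covered by finitely many open sets, each containing only
  finitely many terms of the sequence.\<close>

lemma compactin_sequence_cluster_point:
  fixes \<sigma> :: "nat \<Rightarrow> 'b"
  assumes K: "compactin X K" and \<sigma>: "range \<sigma> \<subseteq> K"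
  obtains k where "k \<in> K" "\<And>U. openin X U \<Longrightarrow> k \<in> U \<Longrightarrow> infinite {n. \<sigma> n \<in> U}"
proof (rule ccontr)
  assume "\<not> thesis"
  then have *: "\<forall>k\<in>K. \<exists>U. openin X U \<and> k \<in> U \<and> finite {n. \<sigma> n \<in> U}"
    using that by blast
  let ?\<U> = "{U. openin X U \<and> finite {n. \<sigma> n \<in> U}}"
  have "K \<subseteq> \<Union>?\<U>" using * by blast
  then obtain \<F> where \<F>: "finite \<F>" "\<F> \<subseteq> ?\<U>" "K \<subseteq> \<Union>\<F>"
    using K unfolding compactin_def by (metis (no_types, lifting) mem_Collect_eq)
  have "UNIV = (\<Union>U\<in>\<F>. {n. \<sigma> n \<in> U})"
    using \<F>(3) \<sigma> by (auto simp: subset_eq)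
  moreover have "finite (\<Union>U\<in>\<F>. {n. \<sigma> n \<in> U})"
    using \<F>(1,2) by auto
  ultimately show False
    using infinite_UNIV_nat by metis
qed

text \<open>The separating functional is the gradient at a minimiser of a finite sum of squared
  evaluations, so no Hahn--Banach theorem for locally convex spaces is needed.\<close>

lemma weak_star_compact_convex_separation:
  fixes p :: "'a::real_normed_vector \<Rightarrow>\<^sub>L real"
  assumes C: "compactin weak_star_topology C" "convex C" "C \<noteq> {}" and "p \<notin> C"
  obtains x where "\<And>\<psi>. \<psi> \<in> C \<Longrightarrow> blinfun_apply \<psi> x < blinfun_apply p x"
proof -
  \<comment> \<open>Each member of \<open>C\<close> differs from \<open>p\<close> at some point. By
    compactness a finite set \<open>S\<close> of points detects this for all of
    \<open>C\<close>.\<close>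
  define U where "U x = {\<psi>. blinfun_apply \<psi> x \<in> - {blinfun_apply p x}}" for x
  have "C \<subseteq> \<Union>(range U)"
    using \<open>p \<notin> C\<close> by (auto simp: U_def) (metis blinfun_eqI)
  moreover have "\<forall>V\<in>range U. openin weak_star_topology V"
    unfolding U_def using openin_weak_star_preimage[OF open_Compl[OF closed_singleton]] by blast
  ultimately obtain \<F> where "finite \<F>" "\<F> \<subseteq> range U" "C \<subseteq> \<Union>\<F>"
    using C(1) unfolding compactin_def by metis
  then obtain S where S: "finite S" "C \<subseteq> (\<Union>x\<in>S. U x)"
    by (metis finite_subset_image)
  \<comment> \<open>\<open>Q\<close> is the squared Euclidean distance to \<open>p\<close> after
    restriction to \<open>S\<close>; by the choice of \<open>S\<close> its minimum over
    \<open>C\<close> is positive.\<close>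
  define Q where "Q \<psi> = (\<Sum>x\<in>S. (blinfun_apply \<psi> x - blinfun_apply p x)\<^sup>2)" for \<psi>
  have "continuous_map weak_star_topology euclideanreal Q"
    unfolding Q_def using S(1) by (intro continuous_intros continuous_map_real_pow) auto
  then have "compact (Q ` C)"
    using image_compactin[OF C(1)] by fastforce
  then obtain \<psi>0 where \<psi>0: "\<psi>0 \<in> C" "\<And>\<psi>. \<psi> \<in> C \<Longrightarrow> Q \<psi>0 \<le> Q \<psi>"
    using compact_attains_inf[of "Q ` C"] \<open>C \<noteq> {}\<close> by blast
  define a where "a x = blinfun_apply \<psi>0 x - blinfun_apply p x" for x
  have "Q \<psi>0 > 0"
  proof -
    obtain x where "x \<in> S" "\<psi>0 \<in> U x" using S \<psi>0 by blast
    then show ?thesis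
      unfolding Q_def using S(1) by (intro sum_pos2[of S x]) (auto simp: U_def)
  qed
  \<comment> \<open>Variational inequality for the nearest point: moving from \<open>\<psi>0\<close>
    towards \<open>\<psi>\<close> by a fraction \<open>s\<close> cannot decrease \<open>Q\<close>.
    Dividing by \<open>s\<close> and letting \<open>s\<close> tend to 0 gives a nonnegative
    derivative; replacing \<open>\<psi>0\<close> by \<open>p\<close> then adds
    \<open>Q \<psi>0 > 0\<close>.\<close>
  have key: "0 < (\<Sum>x\<in>S. a x * (blinfun_apply \<psi> x - blinfun_apply p x))" if "\<psi> \<in> C" for \<psi>
  proof -
    define b where "b x = blinfun_apply \<psi> x - blinfun_apply \<psi>0 x" for x
    have pos: "0 \<le> 2 * (\<Sum>x\<in>S. a x * b x) + s * (\<Sum>x\<in>S. (b x)\<^sup>2)" if s: "0 < s" "s \<le> 1" for s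
    proof -
      have "(1 - s) *\<^sub>R \<psi>0 + s *\<^sub>R \<psi> \<in> C"
        using C(2) \<psi>0(1) \<open>\<psi> \<in> C\<close> s by (intro convexD_alt) auto
      then have "Q \<psi>0 \<le> Q ((1 - s) *\<^sub>R \<psi>0 + s *\<^sub>R \<psi>)"
        by (rule \<psi>0)
      also have "\<dots> = (\<Sum>x\<in>S. (a x)\<^sup>2 + s * (2 * (a x * b x) + s * (b x)\<^sup>2))"
        unfolding Q_def a_def b_def
        by (intro sum.cong refl)
           (simp add: blinfun.add_left blinfun.scaleR_left, simp add: algebra_simps power2_eq_square)
      also have "\<dots> = Q \<psi>0 + s * (2 * (\<Sum>x\<in>S. a x * b x) + s * (\<Sum>x\<in>S. (b x)\<^sup>2))"
        by (simp add: Q_def a_def sum.distrib flip: sum_distrib_left)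
      finally have "0 \<le> s * (2 * (\<Sum>x\<in>S. a x * b x) + s * (\<Sum>x\<in>S. (b x)\<^sup>2))" by simp
      then show ?thesis using s by (simp add: zero_le_mult_iff)
    qed
    have "0 \<le> 2 * (\<Sum>x\<in>S. a x * b x)"
    proof (rule tendsto_lowerbound)
      show "((\<lambda>s. 2 * (\<Sum>x\<in>S. a x * b x) + s * (\<Sum>x\<in>S. (b x)\<^sup>2)) \<longlongrightarrow> 2 * (\<Sum>x\<in>S. a x * b x)) (at_right 0)"
        by (auto intro!: tendsto_eq_intros)
      show "\<forall>\<^sub>F s in at_right 0. 0 \<le> 2 * (\<Sum>x\<in>S. a x * b x) + s * (\<Sum>x\<in>S. (b x)\<^sup>2)"
        using eventually_at_right_less[of 0] eventually_at_right_field[of _ "0::real"] pos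
        by (metis (mono_tags, lifting) less_eq_real_def zero_less_one)
    qed simp
    moreover have "(\<Sum>x\<in>S. a x * (blinfun_apply \<psi> x - blinfun_apply p x)) = (\<Sum>x\<in>S. a x * b x) + Q \<psi>0"
      unfolding Q_def a_def b_def sum.distrib[symmetric]
      by (intro sum.cong refl) (simp add: algebra_simps power2_eq_square)
    ultimately show ?thesis using \<open>Q \<psi>0 > 0\<close> by linarith
  qed
  show thesis
  proof (rule that[of "- (\<Sum>x\<in>S. a x *\<^sub>R x)"])
    fix \<psi> assume "\<psi> \<in> C"
    from key[OF this] show "blinfun_apply \<psi> (- (\<Sum>x\<in>S. a x *\<^sub>R x)) < blinfun_apply p (- (\<Sum>x\<in>S. a x *\<^sub>R x))"
      by (simp add: blinfun.minus_right blinfun.sum_right blinfun.scaleR_right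
          right_diff_distrib sum_subtractf)
  qed
qed

section \<open>Absolutely convex sets and Mackey sets\<close>

lemma absolutely_convex_zero: "absolutely_convex K \<Longrightarrow> K \<noteq> {} \<Longrightarrow> 0 \<in> K"
  unfolding absolutely_convex_def by (metis abs_zero ex_in_conv scaleR_zero_left zero_le_one)

lemma absolutely_convex_uminus: "absolutely_convex K \<Longrightarrow> x \<in> K \<Longrightarrow> - x \<in> K"
  unfolding absolutely_convex_def
  by (metis abs_minus_cancel abs_one order_refl scaleR_minus1_left)

lemma absolutely_convex_Int_subspace:
  "absolutely_convex K \<Longrightarrow> subspace Y \<Longrightarrow> absolutely_convex (K \<inter> Y)"
  unfolding absolutely_convex_def by (simp add: convex_Int subspace_imp_convex subspace_scale)

text \<open>The sum is the image of a compact product under the weak-star continuous addition. Sums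
  make the Mackey sets directed and allow translating a set by multiples of a functional.\<close>

lemma mackey_set_sums:
  assumes "subspace Y" and "mackey_set Y K" "mackey_set Y L"
  shows "mackey_set Y {\<phi> + \<psi> |\<phi> \<psi>. \<phi> \<in> K \<and> \<psi> \<in> L}"
proof -
  let ?w = "weak_star_topology :: ('a \<Rightarrow>\<^sub>L real) topology"
  have eq: "{\<phi> + \<psi> |\<phi> \<psi>. \<phi> \<in> K \<and> \<psi> \<in> L} = (\<lambda>p. fst p + snd p) ` (K \<times> L)"
    by force
  have "continuous_map (prod_topology ?w ?w) ?w (\<lambda>p. fst p + snd p)"
    unfolding continuous_map_weak_star_iff blinfun.add_left
    using continuous_map_compose[OF continuous_map_fst continuous_map_weak_star_apply]
      continuous_map_compose[OF continuous_map_snd continuous_map_weak_star_apply]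
    by (auto simp: o_def intro!: continuous_map_add)
  moreover have "compactin (prod_topology ?w ?w) (K \<times> L)"
    using assms by (simp add: compactin_Times mackey_set_def)
  ultimately have "compactin ?w {\<phi> + \<psi> |\<phi> \<psi>. \<phi> \<in> K \<and> \<psi> \<in> L}"
    unfolding eq using image_compactin by blast
  moreover have "convex {\<phi> + \<psi> |\<phi> \<psi>. \<phi> \<in> K \<and> \<psi> \<in> L}"
    using convex_set_plus[of K L] assms
    by (simp add: mackey_set_def absolutely_convex_def set_plus_def Collect_mono)
       (smt (verit) Collect_cong)
  ultimately show ?thesis
    using assms unfolding mackey_set_def absolutely_convex_def
    by (auto simp: scaleR_add_right intro: subspace_add) blast
qed

text \<open>A continuous linear image of a compact symmetric interval. Segments put every functional
  of \<open>Y\<close> into a Mackey set, so that Mackey convergence implies pointwise convergence on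
  \<open>Y\<close>.\<close>

lemma mackey_set_segment:
  assumes "subspace Y" "\<phi> \<in> Y"
  shows "mackey_set Y ((\<lambda>c. c *\<^sub>R \<phi>) ` {-M..M})"
proof -
  have "continuous_map euclideanreal weak_star_topology (\<lambda>c. c *\<^sub>R \<phi>)"
    by (auto simp: continuous_map_weak_star_iff blinfun.scaleR_left intro!: continuous_intros)
  then have "compactin weak_star_topology ((\<lambda>c. c *\<^sub>R \<phi>) ` {-M..M})"
    by (intro image_compactin[of euclideanreal]) auto
  moreover have "convex ((\<lambda>c. c *\<^sub>R \<phi>) ` {-M..M})"
    by (intro convex_linear_image linearI) (auto simp: scaleR_add_left)
  moreover have "c * d \<in> {-M..M}" if "\<bar>c\<bar> \<le> 1" "d \<in> {-M..M}" for c d :: real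
  proof -
    have "\<bar>c * d\<bar> \<le> 1 * \<bar>d\<bar>"
      unfolding abs_mult using that by (intro mult_right_mono) auto
    then show ?thesis using that by auto
  qed
  ultimately show ?thesis
    using assms unfolding mackey_set_def absolutely_convex_def
    by (auto simp: subspace_scale simp del: atLeastAtMost_iff)
qed

section \<open>Norming subspaces and one-dimensional extensions\<close>

lemma norming_subspace: "norming Y \<Longrightarrow> subspace Y"
  by (simp add: norming_def)

text \<open>Enlarging the unit ball can only raise the supremum, which the dual norm bound keeps
  below \<open>norm x\<close>.\<close>

lemma norming_superset:
  assumes Y: "norming Y" and Z: "subspace Z" "Y \<subseteq> Z"
  shows "norming Z"
proof -
  obtain c where c: "c > 0"
      "\<And>x. c * norm x \<le> (SUP \<phi>\<in>{\<phi>\<in>Y. norm \<phi> \<le> 1}. blinfun_apply \<phi> x)"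
    using Y unfolding norming_def by blast
  have le: "blinfun_apply \<phi> x \<le> norm x" if "norm \<phi> \<le> 1" for \<phi> :: "'a \<Rightarrow>\<^sub>L real" and x
  proof -
    have "blinfun_apply \<phi> x \<le> norm \<phi> * norm x"
      using norm_blinfun[of \<phi> x] by simp
    also have "\<dots> \<le> 1 * norm x" using that by (intro mult_right_mono) auto
    finally show ?thesis by simp
  qed
  have zero: "0 \<in> Y" "0 \<in> Z" using Y Z by (auto simp: norming_def subspace_0)
  have "(SUP \<phi>\<in>{\<phi>\<in>Y. norm \<phi> \<le> 1}. blinfun_apply \<phi> x) \<le> (SUP \<phi>\<in>{\<phi>\<in>Z. norm \<phi> \<le> 1}. blinfun_apply \<phi> x)" for x
    using zero Z(2) le by (intro cSUP_subset_mono bdd_aboveI2[where M = "norm x"]) auto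
  moreover have "(SUP \<phi>\<in>{\<phi>\<in>Z. norm \<phi> \<le> 1}. blinfun_apply \<phi> x) \<le> 1 * norm x" for x
    using zero le by (intro cSUP_least) auto
  ultimately show ?thesis
    unfolding norming_def using Z(1) c by (meson order_trans)
qed

lemma norming_annihilator:
  assumes Y: "norming Y" and "\<And>\<phi>. \<phi> \<in> Y \<Longrightarrow> blinfun_apply \<phi> x = 0"
  shows "x = 0"
proof -
  obtain c where c: "c > 0"
      "c * norm x \<le> (SUP \<phi>\<in>{\<phi>\<in>Y. norm \<phi> \<le> 1}. blinfun_apply \<phi> x)"
    using Y unfolding norming_def by blast
  have "(SUP \<phi>\<in>{\<phi>\<in>Y. norm \<phi> \<le> 1}. blinfun_apply \<phi> x) \<le> 0"
    using assms subspace_0[of Y] by (intro cSUP_least) (auto simp: norming_def intro!: exI[of _ 0])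
  then show ?thesis using c
    by (metis dual_order.trans mult_le_0_iff norm_le_zero_iff not_le)
qed

text \<open>If \<open>\<phi>\<close> has distance \<open>d > 0\<close> from \<open>Y\<close>, the
  coefficient of \<open>\<phi>\<close> is a linear function bounded by \<open>norm z / d\<close>.
  Along a convergent sequence the coefficients are therefore Cauchy, and the
  \<open>Y\<close>-components converge too.\<close>

lemma closed_span_insert:
  fixes \<phi> :: "'b::real_normed_vector"
  assumes Y: "subspace Y" "closed Y"
  shows "closed (span (insert \<phi> Y))"
proof (cases "\<phi> \<in> Y")
  case True
  then show ?thesis using Y by (simp add: insert_absorb span_eq_iff[THEN iffD2])
next
  case False
  define d where "d = infdist \<phi> Y"
  have "d > 0"
    unfolding d_def using Y False by (intro infdist_pos_not_in_closed) (auto dest: subspace_0)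
  have dist: "\<bar>c\<bar> * d \<le> norm z" if "z - c *\<^sub>R \<phi> \<in> Y" for z c
  proof (cases "c = 0")
    case False
    have "\<phi> - (1/c) *\<^sub>R z = (-1/c) *\<^sub>R (z - c *\<^sub>R \<phi>)"
      using False by (simp add: algebra_simps)
    then have "\<phi> - (1/c) *\<^sub>R z \<in> Y" using subspace_scale[OF Y(1) that] by metis
    then have "d \<le> dist \<phi> (\<phi> - (1/c) *\<^sub>R z)"
      unfolding d_def by (rule infdist_le)
    then show ?thesis using False by (simp add: dist_norm field_simps)
  qed simp
  show ?thesis
    unfolding closed_sequential_limits
  proof (intro allI impI, elim conjE)
    fix z l assume "\<forall>n. z n \<in> span (insert \<phi> Y)" and l: "z \<longlonglongrightarrow> l"
    then have "\<forall>n. \<exists>c. z n - c *\<^sub>R \<phi> \<in> Y"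
      using Y by (simp add: span_breakdown_eq span_eq_iff[THEN iffD2])
    then obtain c where c: "\<And>n. z n - c n *\<^sub>R \<phi> \<in> Y" by metis
    have "Cauchy c"
    proof (rule metric_CauchyI)
      fix e :: real assume "e > 0"
      with \<open>d > 0\<close> obtain N where N: "\<And>m n. m \<ge> N \<Longrightarrow> n \<ge> N \<Longrightarrow> dist (z m) (z n) < e * d"
        using LIMSEQ_imp_Cauchy[OF l] metric_CauchyD[of z "e * d"] by auto
      have "dist (c m) (c n) < e" if "m \<ge> N" "n \<ge> N" for m n
      proof -
        have "(z m - z n) - (c m - c n) *\<^sub>R \<phi> \<in> Y"
          using subspace_diff[OF Y(1) c c, of m n] by (simp add: algebra_simps)
        from dist[OF this] N[OF that] have "\<bar>c m - c n\<bar> * d < e * d"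
          by (simp add: dist_norm)
        then show ?thesis using \<open>d > 0\<close> by (simp add: dist_real_def)
      qed
      then show "\<exists>M. \<forall>m\<ge>M. \<forall>n\<ge>M. dist (c m) (c n) < e" by blast
    qed
    then obtain c0 where "c \<longlonglongrightarrow> c0"
      using Cauchy_convergent_iff convergent_def by blast
    then have "(\<lambda>n. z n - c n *\<^sub>R \<phi>) \<longlonglongrightarrow> l - c0 *\<^sub>R \<phi>"
      using l by (intro tendsto_intros)
    then have "l - c0 *\<^sub>R \<phi> \<in> Y"
      using closed_sequentially[OF Y(2), of "\<lambda>n. z n - c n *\<^sub>R \<phi>"] c by simp
    then show "l \<in> span (insert \<phi> Y)"
      using Y(1) by (auto simp: span_breakdown_eq span_eq_iff[THEN iffD2])
  qed
qed

section \<open>A Cauchy filter without a limit\<close>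

lemma not_mackey_complete_span_insert:
  fixes Y :: "('a::real_normed_vector \<Rightarrow>\<^sub>L real) set"
  assumes Y: "norming Y" and \<phi>: "\<phi> \<notin> Y"
    and bnd: "\<And>K. mackey_set (span (insert \<phi> Y)) K \<Longrightarrow>
                \<exists>M. \<forall>\<psi>\<in>K. \<forall>c. \<psi> - c *\<^sub>R \<phi> \<in> Y \<longrightarrow> \<bar>c\<bar> \<le> M"
    and cpt: "\<And>K. mackey_set (span (insert \<phi> Y)) K \<Longrightarrow> compactin weak_star_topology (K \<inter> Y)"
  shows "\<not> mackey_complete (span (insert \<phi> Y))"
proof
  define Z where "Z = span (insert \<phi> Y)"
  assume "mackey_complete (span (insert \<phi> Y))"
  then have complete: "mackey_complete Z" by (simp add: Z_def)
  have sY: "subspace Y" using Y by (rule norming_subspace)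
  have sZ: "subspace Z" by (simp add: Z_def)
  have Z_iff: "\<psi> \<in> Z \<longleftrightarrow> (\<exists>c. \<psi> - c *\<^sub>R \<phi> \<in> Y)" for \<psi>
    using sY by (simp add: Z_def span_breakdown_eq span_eq_iff[THEN iffD2])
  have "Y \<subseteq> Z" "\<phi> \<in> Z" by (auto simp: Z_def span_base)

  \<comment> \<open>\<open>A (K, e)\<close> collects the points whose evaluation is within
    \<open>e\<close> of the coefficient functional on \<open>K\<close>. Quantifying over
    \<open>c\<close> avoids naming that functional.\<close>
  define A where "A p = {x. \<forall>\<psi>\<in>fst p. \<forall>c. \<psi> - c *\<^sub>R \<phi> \<in> Y \<longrightarrow> \<bar>blinfun_apply \<psi> x - c\<bar> \<le> snd p}"
    for p :: "('a \<Rightarrow>\<^sub>L real) set \<times> real"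
  define P where "P = {(K, e). mackey_set Z K \<and> 0 \<in> K \<and> (e::real) > 0}"

  have A_nonempty: "A (K, e) \<noteq> {}" if K: "mackey_set Z K" "0 \<in> K" and "e > 0" for K e
  proof -
    obtain M where M: "\<And>\<psi> c. \<psi> \<in> K \<Longrightarrow> \<psi> - c *\<^sub>R \<phi> \<in> Y \<Longrightarrow> \<bar>c\<bar> \<le> M"
      using bnd K(1) unfolding Z_def by blast
    have "0 \<le> M" using M[of 0 0] K(2) subspace_0[OF sY] by simp
    \<comment> \<open>\<open>L\<close> is large enough to contain the \<open>Y\<close>-component
      \<open>\<psi> - c *\<^sub>R \<phi>\<close> of every \<open>\<psi> \<in> K\<close>, since
      \<open>M\<close> bounds the coefficients. A point separating \<open>e *\<^sub>R \<phi>\<close>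
      from \<open>L \<inter> Y\<close>, scaled to take the value 1 at \<open>\<phi>\<close>, is then
      at most \<open>e\<close> in modulus on these components.\<close>
    define L where "L = {\<psi> + \<omega> |\<psi> \<omega>. \<psi> \<in> K \<and> \<omega> \<in> (\<lambda>c. c *\<^sub>R \<phi>) ` {-M..M}}"
    have L: "mackey_set Z L"
      unfolding L_def using sZ K(1) mackey_set_segment[OF sZ \<open>\<phi> \<in> Z\<close>] by (rule mackey_set_sums)
    then have acL: "absolutely_convex (L \<inter> Y)"
      using sY by (simp add: mackey_set_def absolutely_convex_Int_subspace)
    have "0 \<in> L"
      unfolding L_def using K(2) \<open>0 \<le> M\<close> by (force intro!: image_eqI[of _ _ 0])
    then have 0: "0 \<in> L \<inter> Y" using subspace_0[OF sY] by simp
    have "e *\<^sub>R \<phi> \<notin> L \<inter> Y"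
      using \<phi> \<open>e > 0\<close> subspace_scale[OF sY, of "e *\<^sub>R \<phi>" "1/e"] by auto
    then obtain x where x: "\<And>\<psi>. \<psi> \<in> L \<inter> Y \<Longrightarrow> blinfun_apply \<psi> x < blinfun_apply (e *\<^sub>R \<phi>) x"
      using weak_star_compact_convex_separation[of "L \<inter> Y" "e *\<^sub>R \<phi>"] cpt[of L] L 0 acL
      unfolding absolutely_convex_def Z_def by blast
    define s where "s = blinfun_apply \<phi> x"
    have "s > 0"
      using x[OF 0] \<open>e > 0\<close> by (simp add: s_def blinfun.scaleR_left zero_less_mult_iff)
    have small: "\<bar>blinfun_apply \<psi> x\<bar> \<le> e * s" if "\<psi> \<in> L \<inter> Y" for \<psi>
      using x[OF that] x[OF absolutely_convex_uminus[OF acL that]]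
      by (simp add: s_def blinfun.scaleR_left blinfun.minus_left)
    have "(1/s) *\<^sub>R x \<in> A (K, e)"
    proof -
      have "\<bar>blinfun_apply \<psi> ((1/s) *\<^sub>R x) - c\<bar> \<le> e" if \<psi>: "\<psi> \<in> K" and c: "\<psi> - c *\<^sub>R \<phi> \<in> Y" for \<psi> c
      proof -
        have "\<psi> - c *\<^sub>R \<phi> = \<psi> + (- c) *\<^sub>R \<phi>" by simp
        moreover have "- c \<in> {-M..M}" using M[OF \<psi> c] by auto
        ultimately have "\<psi> - c *\<^sub>R \<phi> \<in> L" unfolding L_def using \<psi> by blast
        then have "\<bar>blinfun_apply \<psi> x - c * s\<bar> \<le> e * s"
          using small[of "\<psi> - c *\<^sub>R \<phi>"] c by (simp add: s_def blinfun.diff_left blinfun.scaleR_left)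
        moreover have "blinfun_apply \<psi> ((1/s) *\<^sub>R x) - c = (blinfun_apply \<psi> x - c * s) / s"
          using \<open>s > 0\<close> by (simp add: blinfun.scaleR_right field_simps)
        ultimately show ?thesis
          using \<open>s > 0\<close> by (simp add: abs_divide divide_le_eq)
      qed
      then show ?thesis by (simp add: A_def)
    qed
    then show ?thesis by blast
  qed

  define F where "F = (INF p\<in>P. principal (A p))"
  have P_segment: "((\<lambda>c. c *\<^sub>R \<psi>) ` {-1..1}, e) \<in> P" if "\<psi> \<in> Z" "e > 0" for \<psi> and e :: real
    using mackey_set_segment[OF sZ that(1), of 1] that(2) by (force simp: P_def intro!: image_eqI[of _ _ 0])
  then have "P \<noteq> {}" using \<open>\<phi> \<in> Z\<close> zero_less_one by blast
  \<comment> \<open>Both sets contain 0, so their sum contains each of them; this is why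
    \<open>P\<close> demands \<open>0 \<in> K\<close>.\<close>
  have directed: "\<exists>r\<in>P. principal (A r) \<le> inf (principal (A p)) (principal (A q))" if pq: "p \<in> P" "q \<in> P" for p q
  proof -
    obtain K d where p: "p = (K, d)" "mackey_set Z K" "0 \<in> K" "d > 0" using pq unfolding P_def by auto
    obtain L e where q: "q = (L, e)" "mackey_set Z L" "0 \<in> L" "e > 0" using pq unfolding P_def by auto
    let ?N = "{\<psi> + \<omega> |\<psi> \<omega>. \<psi> \<in> K \<and> \<omega> \<in> L}"
    have sub: "K \<subseteq> ?N" "L \<subseteq> ?N" using p(3) q(3) by force+
    then have "A (?N, min d e) \<subseteq> A p \<inter> A q"
      unfolding A_def p(1) q(1) by fastforce
    moreover have "(?N, min d e) \<in> P"
      using mackey_set_sums[OF sZ p(2) q(2)] subsetD[OF sub(1) p(3)] p(4) q(4) by (simp add: P_def)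
    ultimately show ?thesis
      unfolding inf_principal principal_le_iff by (rule rev_bexI[rotated])
  qed
  have ev: "eventually R F \<longleftrightarrow> (\<exists>p\<in>P. \<forall>x\<in>A p. R x)" for R
    unfolding F_def using eventually_INF_base[OF \<open>P \<noteq> {}\<close> directed] by (simp add: eventually_principal)
  have "F \<noteq> bot"
    using A_nonempty by (auto simp: ev P_def trivial_limit_def)
  moreover have "eventually (\<lambda>(x, y). \<forall>\<psi>\<in>K. \<bar>blinfun_apply \<psi> x - blinfun_apply \<psi> y\<bar> \<le> e) (F \<times>\<^sub>F F)"
    if K: "mackey_set Z K" and "e > 0" for K and e :: real
  proof (cases "K = {}")
    case False
    then have "(K, e/2) \<in> P"
      using K \<open>e > 0\<close> absolutely_convex_zero by (auto simp: P_def mackey_set_def)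
    then have "eventually (\<lambda>x. x \<in> A (K, e/2)) F" unfolding ev by blast
    moreover have "\<bar>blinfun_apply \<psi> x - blinfun_apply \<psi> y\<bar> \<le> e"
      if xy: "x \<in> A (K, e/2)" "y \<in> A (K, e/2)" "\<psi> \<in> K" for x y \<psi>
    proof -
      obtain c where "\<psi> - c *\<^sub>R \<phi> \<in> Y" using K xy(3) Z_iff by (auto simp: mackey_set_def)
      then have "\<bar>blinfun_apply \<psi> x - c\<bar> \<le> e/2" "\<bar>blinfun_apply \<psi> y - c\<bar> \<le> e/2"
        using xy by (auto simp: A_def)
      then show ?thesis by linarith
    qed
    ultimately show ?thesis
      unfolding eventually_prod_filter by (auto intro!: exI[of _ "\<lambda>x. x \<in> A (K, e/2)"])
  qed (simp add: case_prod_unfold)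
  ultimately obtain x0 where x0: "\<And>K e. mackey_set Z K \<Longrightarrow> e > 0 \<Longrightarrow>
      eventually (\<lambda>y. \<forall>\<psi>\<in>K. \<bar>blinfun_apply \<psi> y - blinfun_apply \<psi> x0\<bar> \<le> e) F"
    using complete unfolding mackey_complete_def by meson
  \<comment> \<open>On the segment through \<open>\<psi>\<close>, the filter forces evaluations
    close both to \<open>c\<close> and to the value at \<open>x0\<close>. Hence evaluation at
    \<open>x0\<close> is the coefficient functional: it vanishes on the norming \<open>Y\<close>, so
    \<open>x0 = 0\<close>, yet it is 1 at \<open>\<phi>\<close>.\<close>
  have val: "blinfun_apply \<psi> x0 = c" if c: "\<psi> - c *\<^sub>R \<phi> \<in> Y" for \<psi> c
  proof -
    have "\<psi> \<in> Z" using c Z_iff by blast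
    let ?K = "(\<lambda>c. c *\<^sub>R \<psi>) ` {-1..1::real}"
    have "\<psi> \<in> ?K" by (rule image_eqI[of _ _ 1]) auto
    have "\<bar>blinfun_apply \<psi> x0 - c\<bar> \<le> 0 + e" if "e > 0" for e
    proof -
      have "e/2 > 0" using that by simp
      have "eventually (\<lambda>x. x \<in> A (?K, e/2)) F"
        unfolding ev using P_segment[OF \<open>\<psi> \<in> Z\<close> \<open>e/2 > 0\<close>] by blast
      then have "eventually (\<lambda>x. \<bar>blinfun_apply \<psi> x - c\<bar> \<le> e/2) F"
        by (rule eventually_mono) (use \<open>\<psi> \<in> ?K\<close> c in \<open>auto simp: A_def\<close>)
      moreover have "eventually (\<lambda>y. \<bar>blinfun_apply \<psi> y - blinfun_apply \<psi> x0\<bar> \<le> e/2) F"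
        using x0[OF mackey_set_segment[OF sZ \<open>\<psi> \<in> Z\<close>] \<open>e/2 > 0\<close>, of 1]
        by (rule eventually_mono) (use \<open>\<psi> \<in> ?K\<close> in blast)
      ultimately have "eventually (\<lambda>x. \<bar>blinfun_apply \<psi> x0 - c\<bar> \<le> 0 + e) F"
        by eventually_elim linarith
      then show ?thesis
        using \<open>F \<noteq> bot\<close> by (simp add: eventually_const)
    qed
    then have "\<bar>blinfun_apply \<psi> x0 - c\<bar> \<le> 0" by (rule field_le_epsilon)
    then show ?thesis by simp
  qed
  have "x0 = 0"
    using Y by (rule norming_annihilator) (simp add: val)
  moreover have "blinfun_apply \<phi> x0 = 1"
    by (rule val) (simp add: subspace_0[OF sY])
  ultimately show False by (simp add: blinfun.zero_right)
qed

section \<open>Common zeros of countable families and the double limit argument\<close>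

text \<open>The set is the intersection of the countably many open sets where the modulus of
  \<open>g n\<close> is below \<open>1 / (m + 1)\<close>.\<close>

lemma gdelta_in_common_zeros:
  fixes g :: "nat \<Rightarrow> 't \<Rightarrow> real"
  assumes "\<And>n. continuous_map T euclideanreal (g n)"
  shows "gdelta_in T {t \<in> topspace T. \<forall>n. g n t = 0}"
proof -
  define U where "U n m = {t \<in> topspace T. g n t \<in> {-inverse (real (Suc m))<..<inverse (real (Suc m))}}" for n m
  have "openin T (U n m)" for n m
    unfolding U_def using assms by (rule openin_continuous_map_preimage) simp
  then have "gdelta_in T (\<Inter>(range (\<lambda>(n, m). U n m)))"
    by (intro gdelta_in_Inter) (auto intro: open_imp_gdelta_in)
  also have "\<Inter>(range (\<lambda>(n, m). U n m)) = {t \<in> topspace T. \<forall>n. g n t = 0}"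
  proof (intro equalityI subsetI)
    fix t assume t: "t \<in> \<Inter>(range (\<lambda>(n, m). U n m))"
    have "\<bar>g n t\<bar> < inverse (real (Suc m))" for n m
    proof -
      have "t \<in> U n m" using t by force
      then show ?thesis by (auto simp: U_def)
    qed
    then have "\<not> 0 < \<bar>g n t\<bar>" for n
      using reals_Archimedean[of "\<bar>g n t\<bar>"] by (meson not_less_iff_gr_or_eq)
    then show "t \<in> {t \<in> topspace T. \<forall>n. g n t = 0}"
      using t by (auto simp: U_def)
  qed (auto simp: U_def)
  finally show ?thesis .
qed

text \<open>The assumption \<open>common_zero\<close> condenses the G-delta hypothesis and
  \<open>f inf = 0\<close> into the form used below: countably many members of \<open>Y\<close>
  vanish together at some \<open>f t\<close> where \<open>\<phi>\<close> exceeds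
  \<open>\<epsilon>\<close>.\<close>

locale discontinuous_functional =
  fixes T :: "'t topology" and f :: "'t \<Rightarrow> 'a::real_normed_vector"
    and \<epsilon> :: real and \<phi> :: "'a \<Rightarrow>\<^sub>L real" and Y :: "('a \<Rightarrow>\<^sub>L real) set"
  assumes Y_def: "Y = {\<psi>. continuous_map T euclideanreal (\<lambda>t. blinfun_apply \<psi> (f t))}"
    and subspace_Y: "subspace Y"
    and \<epsilon>_pos: "\<epsilon> > 0"
    and common_zero: "\<And>y :: nat \<Rightarrow> 'a \<Rightarrow>\<^sub>L real. range y \<subseteq> Y \<Longrightarrow>
          \<exists>t\<in>topspace T. blinfun_apply \<phi> (f t) > \<epsilon> \<and> (\<forall>n. blinfun_apply (y n) (f t) = 0)"
begin

lemma common_zero_countable: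
  assumes "countable B" "B \<subseteq> Y"
  obtains t where "t \<in> topspace T" "blinfun_apply \<phi> (f t) > \<epsilon>"
    "\<And>\<psi>. \<psi> \<in> B \<Longrightarrow> blinfun_apply \<psi> (f t) = 0"
proof -
  \<comment> \<open>Adding 0 keeps the set nonempty, as an enumeration by the naturals
    requires.\<close>
  define y where "y = from_nat_into (insert 0 B)"
  have "range y = insert 0 B"
    unfolding y_def using assms(1) by (intro range_from_nat_into) auto
  moreover have "insert 0 B \<subseteq> Y" using assms subspace_0[OF subspace_Y] by blast
  ultimately obtain t where "t \<in> topspace T" "blinfun_apply \<phi> (f t) > \<epsilon>"
      "\<And>n. blinfun_apply (y n) (f t) = 0" and "range y = insert 0 B"
    using common_zero[of y] by auto
  moreover from this have "blinfun_apply \<psi> (f t) = 0" if "\<psi> \<in> B" for \<psi>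
    using that by (metis insertI2 rangeE)
  ultimately show thesis using that by blast
qed

text \<open>Weak-star limits of countable subsets of \<open>Y\<close> that lie in \<open>Y \<oplus> \<real> \<phi>\<close> stay in \<open>Y\<close>.\<close>

lemma coefficient_eq_0_if_approximable:
  assumes "countable B" "B \<subseteq> Y" and z: "z - c *\<^sub>R \<phi> \<in> Y"
    and approx: "\<And>x e. e > 0 \<Longrightarrow> \<exists>\<psi>\<in>B. \<bar>blinfun_apply \<psi> x - blinfun_apply z x\<bar> < e"
  shows "c = 0"
proof (rule ccontr)
  assume "c \<noteq> 0"
  \<comment> \<open>Test at a common zero of \<open>B\<close> and of the \<open>Y\<close>-component
    of \<open>z\<close>: there \<open>z\<close> equals \<open>c\<close> times a value above
    \<open>\<epsilon>\<close>, while all approximants vanish.\<close>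
  obtain t where t: "blinfun_apply \<phi> (f t) > \<epsilon>"
    "\<And>\<psi>. \<psi> \<in> insert (z - c *\<^sub>R \<phi>) B \<Longrightarrow> blinfun_apply \<psi> (f t) = 0"
    by (rule common_zero_countable[of "insert (z - c *\<^sub>R \<phi>) B"]) (use assms(1-3) in auto)
  have "blinfun_apply z (f t) = c * blinfun_apply \<phi> (f t)"
    using t(2)[of "z - c *\<^sub>R \<phi>"] by (simp add: blinfun.diff_left blinfun.scaleR_left)
  moreover have "\<not> 0 < \<bar>blinfun_apply z (f t)\<bar>"
    using approx[of "\<bar>blinfun_apply z (f t)\<bar>" "f t"] t(2) by fastforce
  ultimately show False using \<open>c \<noteq> 0\<close> t(1) \<epsilon>_pos by simp
qed

lemma \<phi>_notin_Y: "\<phi> \<notin> Y"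
proof
  assume "\<phi> \<in> Y"
  then obtain t where "blinfun_apply \<phi> (f t) > \<epsilon>" "blinfun_apply \<phi> (f t) = 0"
    using common_zero_countable[of "{\<phi>}"] by auto
  then show False using \<epsilon>_pos by simp
qed

text \<open>If coefficients \<open>c n\<close> were unbounded along \<open>\<psi> n \<in> K\<close>,
  the members \<open>\<psi> n / c n - \<phi>\<close> of \<open>Y\<close> would approach
  \<open>-\<phi>\<close> pointwise, as \<open>K\<close> is pointwise bounded. The coefficient of
  \<open>-\<phi>\<close> would then be 0 instead of -1.\<close>

lemma coefficients_bounded:
  assumes K: "compactin weak_star_topology K"
  shows "\<exists>M. \<forall>\<psi>\<in>K. \<forall>c. \<psi> - c *\<^sub>R \<phi> \<in> Y \<longrightarrow> \<bar>c\<bar> \<le> M"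
proof (rule ccontr)
  assume "\<not> ?thesis"
  then have "\<forall>n. \<exists>\<psi> c. \<psi> \<in> K \<and> \<psi> - c *\<^sub>R \<phi> \<in> Y \<and> \<bar>c\<bar> > real (Suc n)"
    by (meson not_le)
  then obtain \<psi> c where \<psi>: "\<And>n. \<psi> n \<in> K" "\<And>n. \<psi> n - c n *\<^sub>R \<phi> \<in> Y"
    and c: "\<And>n. \<bar>c n\<bar> > real (Suc n)" by metis
  define y where "y n = (1 / c n) *\<^sub>R (\<psi> n - c n *\<^sub>R \<phi>)" for n
  have "c n \<noteq> 0" for n using c[of n] by auto
  have "(-1::real) = 0"
  proof (rule coefficient_eq_0_if_approximable[of "range y" "-\<phi>"])
    show "range y \<subseteq> Y" using \<psi>(2) subspace_Y by (auto simp: y_def intro: subspace_scale)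
    fix x and e :: real assume "e > 0"
    obtain B where B: "\<And>\<psi>. \<psi> \<in> K \<Longrightarrow> \<bar>blinfun_apply \<psi> x\<bar> \<le> B"
      using compactin_weak_star_bounded[OF K] by blast
    obtain n where "B / e < real n" using reals_Archimedean2 by blast
    then have "B < e * real n" using \<open>e > 0\<close> by (simp add: field_simps)
    also have "\<dots> < e * \<bar>c n\<bar>" using c[of n] \<open>e > 0\<close> by simp
    finally have "\<bar>blinfun_apply (\<psi> n) x\<bar> < e * \<bar>c n\<bar>" using B[OF \<psi>(1)[of n]] by linarith
    then have "\<bar>blinfun_apply (\<psi> n) x / c n\<bar> < e"
      using \<open>c n \<noteq> 0\<close> by (simp add: abs_divide divide_less_eq)
    moreover have "blinfun_apply (y n) x - blinfun_apply (-\<phi>) x = blinfun_apply (\<psi> n) x / c n"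
      using \<open>c n \<noteq> 0\<close>
      by (simp add: y_def blinfun.scaleR_left blinfun.diff_left blinfun.minus_left field_simps)
    ultimately show "\<exists>\<psi>\<in>range y. \<bar>blinfun_apply \<psi> x - blinfun_apply (-\<phi>) x\<bar> < e"
      by (metis rangeI)
  qed (simp_all add: subspace_0[OF subspace_Y])
  then show False by simp
qed

text \<open>Were some \<open>z \<in> K - Y\<close> in the weak-star closure of \<open>K \<inter> Y\<close>, one could build \<open>y\<^sub>n \<in> K \<inter> Y\<close> and
  points \<open>t\<^sub>n\<close> with \<open>y\<^sub>i (f t\<^sub>n) = 0\<close> for \<open>i \<le> n\<close> and \<open>s y\<^sub>j (f t\<^sub>i) \<ge> \<eta> > 0\<close> for \<open>i < j\<close>
  (\<open>s\<close> a sign). Evaluating a cluster point of \<open>y\<^sub>n\<close> at a cluster point of \<open>t\<^sub>n\<close> gives a contradiction.\<close>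

lemma compactin_Int_Y:
  assumes T: "countably_compact_space T"
    and K: "compactin weak_star_topology K" "K \<subseteq> span (insert \<phi> Y)"
  shows "compactin weak_star_topology (K \<inter> Y)"
proof -
  have sep: "\<exists>U. openin weak_star_topology U \<and> z \<in> U \<and> U \<inter> (K \<inter> Y) = {}" if "z \<in> K" "z \<notin> Y" for z
  proof (rule ccontr)
    assume contr: "\<not> ?thesis"
    have coeff: "\<exists>c. \<psi> - c *\<^sub>R \<phi> \<in> Y" if "\<psi> \<in> K" for \<psi>
      using K(2) that subspace_Y by (auto simp: span_breakdown_eq span_eq_iff[THEN iffD2])
    obtain c where c: "z - c *\<^sub>R \<phi> \<in> Y" using coeff[OF \<open>z \<in> K\<close>] by blast
    have "c \<noteq> 0" using c \<open>z \<notin> Y\<close> by auto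
    \<comment> \<open>Wherever \<open>z - c *\<^sub>R \<phi>\<close> vanishes and
      \<open>\<phi>\<close> exceeds \<open>\<epsilon>\<close>, the modulus of \<open>z\<close> is at
      least \<open>2 * \<eta>\<close>; an approximation within \<open>\<eta>\<close> keeps the sign
      and modulus at least \<open>\<eta>\<close>.\<close>
    define \<eta> where "\<eta> = \<bar>c\<bar> * \<epsilon> / 2"
    have "\<eta> > 0" using \<open>c \<noteq> 0\<close> \<epsilon>_pos by (simp add: \<eta>_def)
    have approx: "\<exists>\<psi>\<in>K \<inter> Y. \<forall>x\<in>S. \<bar>blinfun_apply \<psi> x - blinfun_apply z x\<bar> < \<eta>" if "finite S" for S
    proof -
      let ?U = "\<Inter>((\<lambda>x. {\<psi>. blinfun_apply \<psi> x \<in> ball (blinfun_apply z x) \<eta>}) ` S)"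
      have "openin weak_star_topology (?U \<inter> topspace weak_star_topology)"
        using that openin_weak_star_preimage[OF open_ball] openin_topspace[of weak_star_topology]
        by (induction S rule: finite_induct) (auto simp del: mem_ball intro!: openin_Int)
      then have "?U \<inter> (K \<inter> Y) \<noteq> {}"
        using contr \<open>\<eta> > 0\<close> by auto
      then show ?thesis
        by (auto simp: dist_real_def abs_minus_commute)
    qed
    \<comment> \<open>At stage \<open>n\<close> the functional is chosen first, close to
      \<open>z\<close> at all earlier points; then the point is chosen as a common zero of all
      functionals so far, the new one included, and of
      \<open>z - c *\<^sub>R \<phi>\<close>.\<close>
    let ?P = "\<lambda>h n r. fst r \<in> K \<inter> Y \<and> snd r \<in> topspace T \<and> blinfun_apply \<phi> (f (snd r)) > \<epsilon>
      \<and> blinfun_apply (z - c *\<^sub>R \<phi>) (f (snd r)) = 0 \<and> blinfun_apply (fst r) (f (snd r)) = 0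
      \<and> (\<forall>i<n. blinfun_apply (fst (h i)) (f (snd r)) = 0
            \<and> \<bar>blinfun_apply (fst r) (f (snd (h i))) - blinfun_apply z (f (snd (h i)))\<bar> < \<eta>)"
    have "\<exists>h :: nat \<Rightarrow> ('a \<Rightarrow>\<^sub>L real) \<times> 't. \<forall>n. ?P h n (h n)"
    proof (rule dependent_wellorder_choice)
      fix n and h :: "nat \<Rightarrow> ('a \<Rightarrow>\<^sub>L real) \<times> 't"
      assume IH: "\<And>i. i < n \<Longrightarrow> ?P h i (h i)"
      obtain \<psi> where \<psi>: "\<psi> \<in> K \<inter> Y"
        "\<forall>x\<in>(\<lambda>i. f (snd (h i))) ` {..<n}. \<bar>blinfun_apply \<psi> x - blinfun_apply z x\<bar> < \<eta>"
        using approx[of "(\<lambda>i. f (snd (h i))) ` {..<n}"] by auto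
      have "insert \<psi> (insert (z - c *\<^sub>R \<phi>) ((\<lambda>i. fst (h i)) ` {..<n})) \<subseteq> Y"
        using \<psi> c IH by auto
      then obtain t where "t \<in> topspace T" "blinfun_apply \<phi> (f t) > \<epsilon>"
        "\<And>\<omega>. \<omega> \<in> insert \<psi> (insert (z - c *\<^sub>R \<phi>) ((\<lambda>i. fst (h i)) ` {..<n})) \<Longrightarrow> blinfun_apply \<omega> (f t) = 0"
        using common_zero_countable[of "insert \<psi> (insert (z - c *\<^sub>R \<phi>) ((\<lambda>i. fst (h i)) ` {..<n}))"]
        by auto
      then show "\<exists>r. ?P h n r"
        using \<psi> by (intro exI[of _ "(\<psi>, t)"]) auto
    qed auto
    then obtain h :: "nat \<Rightarrow> ('a \<Rightarrow>\<^sub>L real) \<times> 't" where h: "\<And>n. ?P h n (h n)" by blast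
    define y where "y n = fst (h n)" for n
    define t where "t n = snd (h n)" for n
    have y: "y n \<in> K" "y n \<in> Y" for n
      using h[of n] by (auto simp: y_def)
    have t: "t n \<in> topspace T" "blinfun_apply \<phi> (f (t n)) > \<epsilon>"
      "blinfun_apply z (f (t n)) = c * blinfun_apply \<phi> (f (t n))" for n
      using h[of n] by (auto simp: t_def blinfun.diff_left blinfun.scaleR_left)
    have zero: "blinfun_apply (y i) (f (t n)) = 0" if "i \<le> n" for i n
      using h[of n] that by (cases "i = n") (auto simp: y_def t_def)
    have near: "\<bar>blinfun_apply (y j) (f (t i)) - blinfun_apply z (f (t i))\<bar> < \<eta>" if "i < j" for i j
      using h[of j] that by (simp add: y_def t_def)
    have large: "sgn c * blinfun_apply (y j) (f (t i)) \<ge> \<eta>" if "i < j" for i j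
    proof -
      have "\<bar>c\<bar> * \<epsilon> \<le> \<bar>c\<bar> * blinfun_apply \<phi> (f (t i))"
        using t(2)[of i] by (intro mult_left_mono) auto
      then have "2 * \<eta> \<le> sgn c * blinfun_apply z (f (t i))"
        by (simp add: \<eta>_def t(3) abs_sgn algebra_simps)
      moreover have "\<bar>sgn c * blinfun_apply (y j) (f (t i)) - sgn c * blinfun_apply z (f (t i))\<bar> < \<eta>"
        using near[OF that] \<open>c \<noteq> 0\<close> by (simp add: abs_mult abs_sgn_eq flip: right_diff_distrib)
      ultimately show ?thesis by linarith
    qed

    obtain k where k: "k \<in> K"
      "\<And>U. openin weak_star_topology U \<Longrightarrow> k \<in> U \<Longrightarrow> infinite {n. y n \<in> U}"
      using compactin_sequence_cluster_point[OF K(1), of y] y by blast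
    have k_near: "infinite {n. \<bar>blinfun_apply (y n) x - blinfun_apply k x\<bar> < e}" if "e > 0" for x e
      using k(2)[OF openin_weak_star_preimage[of "ball (blinfun_apply k x) e" x]] that
      by (simp add: dist_real_def abs_minus_commute)
    \<comment> \<open>Membership in \<open>Y\<close> makes \<open>k\<close> composed with
      \<open>f\<close> continuous, so that its values at the \<open>t n\<close> cluster at its value
      at \<open>t0\<close>.\<close>
    have "k \<in> Y"
    proof -
      obtain a where a: "k - a *\<^sub>R \<phi> \<in> Y" using coeff[OF k(1)] by blast
      have "a = 0"
      proof (rule coefficient_eq_0_if_approximable[of "range y" k])
        fix x and e :: real assume "e > 0"
        from k_near[OF this, of x] show "\<exists>\<psi>\<in>range y. \<bar>blinfun_apply \<psi> x - blinfun_apply k x\<bar> < e"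
          using not_finite_existsD by auto
      qed (use y a in auto)
      then show ?thesis using a by simp
    qed
    obtain t0 where t0: "t0 \<in> topspace T"
      "\<And>U. openin T U \<Longrightarrow> t0 \<in> U \<Longrightarrow> infinite {n. t n \<in> U}"
      using T t(1) unfolding countably_compact_space_def by (metis image_subsetI)
    have t0_near: "infinite {n. \<bar>blinfun_apply \<psi> (f (t n)) - blinfun_apply \<psi> (f t0)\<bar> < e}"
      if "\<psi> \<in> Y" "e > 0" for \<psi> e
    proof -
      have "openin T {t \<in> topspace T. blinfun_apply \<psi> (f t) \<in> ball (blinfun_apply \<psi> (f t0)) e}"
        using that(1) unfolding Y_def by (intro openin_continuous_map_preimage) auto
      from t0(2)[OF this] show ?thesis
        using t0(1) that(2) t(1) by (simp add: dist_real_def abs_minus_commute)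
    qed
    \<comment> \<open>\<open>y j\<close> vanishes at \<open>f (t n)\<close> for all
      \<open>n \<ge> j\<close>, and its composition with \<open>f\<close> is continuous.\<close>
    have y_t0: "blinfun_apply (y j) (f t0) = 0" for j
    proof (rule ccontr)
      assume "blinfun_apply (y j) (f t0) \<noteq> 0"
      then have "infinite {n. \<bar>blinfun_apply (y j) (f (t n)) - blinfun_apply (y j) (f t0)\<bar> < \<bar>blinfun_apply (y j) (f t0)\<bar>}"
        using y(2) by (intro t0_near) auto
      then obtain n where "j < n" "\<bar>blinfun_apply (y j) (f (t n)) - blinfun_apply (y j) (f t0)\<bar> < \<bar>blinfun_apply (y j) (f t0)\<bar>"
        unfolding infinite_nat_iff_unbounded by blast
      then show False using zero[of j n] by simp
    qed
    \<comment> \<open>Three errors of \<open>\<eta> / 3\<close> add up: \<open>k\<close> is small at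
      \<open>f t0\<close> because \<open>y n\<close> vanishes there, hence \<open>k\<close> is small
      at some \<open>f (t i)\<close>, hence so is some \<open>y j\<close> with \<open>j > i\<close>,
      against the lower bound \<open>\<eta>\<close>.\<close>
    obtain n where n: "\<bar>blinfun_apply (y n) (f t0) - blinfun_apply k (f t0)\<bar> < \<eta> / 3"
      using not_finite_existsD[OF k_near[of "\<eta> / 3" "f t0"]] \<open>\<eta> > 0\<close> by auto
    obtain i where i: "\<bar>blinfun_apply k (f (t i)) - blinfun_apply k (f t0)\<bar> < \<eta> / 3"
      using not_finite_existsD[OF t0_near[OF \<open>k \<in> Y\<close>, of "\<eta> / 3"]] \<open>\<eta> > 0\<close> by auto
    have "infinite {n. \<bar>blinfun_apply (y n) (f (t i)) - blinfun_apply k (f (t i))\<bar> < \<eta> / 3}"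
      using \<open>\<eta> > 0\<close> by (intro k_near) simp
    then obtain j where "i < j" and j: "\<bar>blinfun_apply (y j) (f (t i)) - blinfun_apply k (f (t i))\<bar> < \<eta> / 3"
      unfolding infinite_nat_iff_unbounded by blast
    have "\<bar>blinfun_apply (y j) (f (t i))\<bar> < \<eta>"
      using n i j y_t0[of n] by linarith
    moreover have "\<eta> \<le> \<bar>blinfun_apply (y j) (f (t i))\<bar>"
      using large[OF \<open>i < j\<close>] \<open>c \<noteq> 0\<close> by (auto simp: sgn_if split: if_splits)
    ultimately show False by simp
  qed
  have "closedin (subtopology weak_star_topology K) (K \<inter> Y)"
  proof -
    have "openin (subtopology weak_star_topology K) (K - Y)"
    proof (subst openin_subopen, intro ballI)
      fix z assume "z \<in> K - Y"
      then obtain U where "openin weak_star_topology U" "z \<in> U" "U \<inter> (K \<inter> Y) = {}" using sep by blast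
      then show "\<exists>V. openin (subtopology weak_star_topology K) V \<and> z \<in> V \<and> V \<subseteq> K - Y"
        using \<open>z \<in> K - Y\<close> by (intro exI[of _ "K \<inter> U"]) (auto simp: openin_subtopology_Int2)
    qed
    moreover have "K - (K \<inter> Y) = K - Y" by blast
    ultimately show ?thesis by (simp add: closedin_def)
  qed
  then show ?thesis
    using K(1) closedin_compact_space compactin_subspace compactin_subtopology by metis
qed

end

section \<open>Failure of full Mackey completeness\<close>

theorem theorem4p1:
  fixes T :: "'t topology" and inf :: 't and f :: "'t \<Rightarrow> 'a::banach"
  assumes "Hausdorff_space T" and "countably_compact_space T"
    and "inf \<in> topspace T"
    and "f inf = 0"
    and "norming {\<phi>. continuous_map T euclideanreal (\<lambda>t. blinfun_apply \<phi> (f t))}"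
    and "closed {\<phi>. continuous_map T euclideanreal (\<lambda>t. blinfun_apply \<phi> (f t))}"
    and "\<exists>\<epsilon>::real>0. \<exists>\<phi>inf::'a \<Rightarrow>\<^sub>L real.
           \<forall>G. gdelta_in T G \<and> inf \<in> G \<longrightarrow>
             {t\<in>topspace T. blinfun_apply \<phi>inf (f t) > \<epsilon>} \<inter> G \<noteq> {}"
  shows "\<not> fully_mackey_complete TYPE('a)"
proof -
  define Y where "Y = {\<phi>. continuous_map T euclideanreal (\<lambda>t. blinfun_apply \<phi> (f t))}"
  have Y: "norming Y" "closed Y" using assms(5,6) by (simp_all add: Y_def)
  obtain \<epsilon> :: real and \<phi> :: "'a \<Rightarrow>\<^sub>L real" where "\<epsilon> > 0"
    and D: "\<And>G. gdelta_in T G \<Longrightarrow> inf \<in> G \<Longrightarrow> {t\<in>topspace T. blinfun_apply \<phi> (f t) > \<epsilon>} \<inter> G \<noteq> {}"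
    using assms(7) by blast
  interpret discontinuous_functional T f \<epsilon> \<phi> Y
  proof
    fix y :: "nat \<Rightarrow> 'a \<Rightarrow>\<^sub>L real" assume "range y \<subseteq> Y"
    then have "gdelta_in T {t \<in> topspace T. \<forall>n. blinfun_apply (y n) (f t) = 0}"
      by (intro gdelta_in_common_zeros) (auto simp: Y_def)
    \<comment> \<open>The zero set contains \<open>inf\<close> because \<open>f inf = 0\<close>, so
      it meets the set where \<open>\<phi>\<close> exceeds \<open>\<epsilon>\<close>.\<close>
    from D[OF this]
    show "\<exists>t\<in>topspace T. blinfun_apply \<phi> (f t) > \<epsilon> \<and> (\<forall>n. blinfun_apply (y n) (f t) = 0)"
      using assms(3,4) by (auto simp: blinfun.zero_right)
  qed (use Y \<open>\<epsilon> > 0\<close> in \<open>auto simp: Y_def norming_subspace\<close>)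
  have "\<not> mackey_complete (span (insert \<phi> Y))"
    using Y(1) \<phi>_notin_Y
  proof (rule not_mackey_complete_span_insert)
    fix K assume K: "mackey_set (span (insert \<phi> Y)) K"
    then show "\<exists>M. \<forall>\<psi>\<in>K. \<forall>c. \<psi> - c *\<^sub>R \<phi> \<in> Y \<longrightarrow> \<bar>c\<bar> \<le> M"
      by (intro coefficients_bounded) (simp add: mackey_set_def)
    show "compactin weak_star_topology (K \<inter> Y)"
      using K assms(2) by (intro compactin_Int_Y) (simp_all add: mackey_set_def)
  qed
  moreover have "norming (span (insert \<phi> Y))"
    using Y(1) by (rule norming_superset) (auto simp: span_base)
  moreover have "closed (span (insert \<phi> Y))"
    using subspace_Y Y(2) by (rule closed_span_insert)
  ultimately show ?thesis
    unfolding fully_mackey_complete_def by blast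
qed

end
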